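(* Let $(T,\omega)$ and $(T',\omega')$ be weighted $2$-stars such that $M_{(T,\mathsf m_\omega)}(\mathbf z)=M_{(T',\mathsf m_{\omega'})}(\mathbf z)$. Then $(T,\omega)$ and $(T',\omega')$ are $\omega$-isomorphic. (That is, a weighted $2$-star can be reconstructed from its $M$-polynomial.)
   Context: A $2$-star is a tree obtained by taking two disjoint stars and joining their centers by an edge. A weighted tree is $(T,\omega)$, $\omega:V(T)\to\{1,2,\dots\}$; two weighted graphs are $\omega$-isomorphic if there is a graph isomorphism preserving weights. The marked version $\mathsf m_\omega$ gives vertex $v$ the mark $(\omega(v),0)$; marks are pairs $(w,d)$ with dot-sum $(w,d)\dotplus(w',d')=(w+w',d+d'+1)$. For a marked tree, $M_{(T,\mathsf m)}(\mathbf z)=\sum_{A\subseteq E(T)}\prod_C z_{\mathsf m(C)}$, where $C$ ranges over connected components of $(V(T),A)$, $\mathsf m(C)$ is the dot-sum of the marks of the vertices of $C$, and the $z_{w,d}$ are commuting indeterminates. *)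

theory Defs
  imports "HOL-Library.Poly_Mapping"
begin

text \<open>A finite simple graph is given by its vertex set \<open>V\<close> and its edge set \<open>E\<close>, each edge being
  the two-element set of its endpoints.\<close>

text \<open>The star with center \<open>c\<close> on \<open>V\<close>. A single vertex is a star without leaves, and in the star
  with one leaf either vertex may serve as the center.\<close>

definition star :: "'a set \<Rightarrow> 'a set set \<Rightarrow> 'a \<Rightarrow> bool" where
  "star V E c \<longleftrightarrow> finite V \<and> c \<in> V \<and> E = (\<lambda>v. {c, v}) ` (V - {c})"

definition two_star :: "'a set \<Rightarrow> 'a set set \<Rightarrow> bool" where
  "two_star V E \<longleftrightarrow>
     (\<exists>V1 E1 c1 V2 E2 c2. star V1 E1 c1 \<and> star V2 E2 c2 \<and> V1 \<inter> V2 = {} \<and>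
        V = V1 \<union> V2 \<and> E = insert {c1, c2} (E1 \<union> E2))"

definition weighting :: "'a set \<Rightarrow> ('a \<Rightarrow> nat) \<Rightarrow> bool" where
  "weighting V \<omega> \<longleftrightarrow> (\<forall>v\<in>V. 1 \<le> \<omega> v)"

definition weighted_two_star :: "'a set \<Rightarrow> 'a set set \<Rightarrow> ('a \<Rightarrow> nat) \<Rightarrow> bool" where
  "weighted_two_star V E \<omega> \<longleftrightarrow> two_star V E \<and> weighting V \<omega>"

definition weight_isomorphic ::
    "'a set \<Rightarrow> 'a set set \<Rightarrow> ('a \<Rightarrow> nat) \<Rightarrow> 'b set \<Rightarrow> 'b set set \<Rightarrow> ('b \<Rightarrow> nat) \<Rightarrow> bool" where
  "weight_isomorphic V E \<omega> V' E' \<omega>' \<longleftrightarrow>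
     (\<exists>f. bij_betw f V V' \<and>
          (\<forall>u\<in>V. \<forall>v\<in>V. {u, v} \<in> E \<longleftrightarrow> {f u, f v} \<in> E') \<and>
          (\<forall>v\<in>V. \<omega>' (f v) = \<omega> v))"

type_synonym mark = "nat \<times> nat"

fun dotplus :: "mark \<Rightarrow> mark \<Rightarrow> mark" (infixl \<open>\<dotplus>\<close> 65) where
  "(w, d) \<dotplus> (w', d') = (w + w', d + d' + 1)"

definition marked_version :: "('a \<Rightarrow> nat) \<Rightarrow> 'a \<Rightarrow> mark" where
  "marked_version \<omega> v = (\<omega> v, 0)"

text \<open>The operation \<open>\<dotplus>\<close> is associative and commutative but has no neutral element; \<open>None\<close> plays
  that role while the marks of a nonempty finite set are added up.\<close>

definition dot_sum :: "('a \<Rightarrow> mark) \<Rightarrow> 'a set \<Rightarrow> mark" where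
  "dot_sum m C =
     the (Finite_Set.fold
            (\<lambda>v s. case s of None \<Rightarrow> Some (m v) | Some t \<Rightarrow> Some (m v \<dotplus> t)) None C)"

interpretation dot_fold: comp_fun_commute
  "\<lambda>v s. case s of None \<Rightarrow> Some (m v) | Some t \<Rightarrow> Some (m v \<dotplus> t)" for m :: "'a \<Rightarrow> mark"
proof
  show "(\<lambda>s. case s of None \<Rightarrow> Some (m y) | Some t \<Rightarrow> Some (m y \<dotplus> t)) \<circ>
        (\<lambda>s. case s of None \<Rightarrow> Some (m x) | Some t \<Rightarrow> Some (m x \<dotplus> t)) =
        (\<lambda>s. case s of None \<Rightarrow> Some (m x) | Some t \<Rightarrow> Some (m x \<dotplus> t)) \<circ>
        (\<lambda>s. case s of None \<Rightarrow> Some (m y) | Some t \<Rightarrow> Some (m y \<dotplus> t))" for x y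
    by (cases "m x"; cases "m y") (auto simp: fun_eq_iff split: option.split)
qed

lemma dot_sum_singleton: "dot_sum m {v} = m v"
  by (simp add: dot_sum_def)

lemma dot_sum_insert:
  assumes "finite C" "C \<noteq> {}" "v \<notin> C"
  shows "dot_sum m (insert v C) = m v \<dotplus> dot_sum m C"
proof -
  obtain u D where "C = insert u D" "u \<notin> D" "finite D"
    using assms by (metis Set.set_insert ex_in_conv finite_insert)
  then show ?thesis
    using assms by (auto simp: dot_sum_def split: option.split)
qed

lemma dot_sum_closed_form:
  assumes "finite C" "C \<noteq> {}"
  shows "dot_sum m C = (\<Sum>v\<in>C. fst (m v), (\<Sum>v\<in>C. snd (m v)) + (card C - 1))"
  using assms
proof (induction C rule: finite_ne_induct)
  case (singleton v)
  then show ?case by (simp add: dot_sum_singleton)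
next
  case (insert v C)
  then have "card C > 0" by (simp add: card_gt_0_iff)
  with insert show ?case
    by (cases "m v") (simp add: dot_sum_insert)
qed

text \<open>Connected components of the spanning subgraph \<open>(V, A)\<close>, as vertex sets.\<close>

definition joined :: "'a set \<Rightarrow> 'a set set \<Rightarrow> ('a \<times> 'a) set" where
  "joined V A = {(u, v) \<in> V \<times> V. (u, v) \<in> {(x, y). {x, y} \<in> A}\<^sup>*}"

definition graph_components :: "'a set \<Rightarrow> 'a set set \<Rightarrow> 'a set set" where
  "graph_components V A = V // joined V A"

text \<open>The polynomial ring over the integers in the commuting indeterminates \<open>z\<^sub>w\<^sub>,\<^sub>d\<close>: finitely
  supported maps from monomials (finitely supported exponent functions on marks) to coefficients,
  with the convolution product.\<close>

type_synonym mark_poly = "(mark \<Rightarrow>\<^sub>0 nat) \<Rightarrow>\<^sub>0 int"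

definition zvar :: "mark \<Rightarrow> mark_poly" where
  "zvar p = Poly_Mapping.single (Poly_Mapping.single p 1) 1"

definition M_poly :: "'a set \<Rightarrow> 'a set set \<Rightarrow> ('a \<Rightarrow> mark) \<Rightarrow> mark_poly" where
  "M_poly V E m = (\<Sum>A\<in>Pow E. \<Prod>C\<in>graph_components V A. zvar (dot_sum m C))"

end

theory Submission
  imports Defs "HOL-Library.Multiset"
begin

text \<open>Equality of the polynomials means equality of the multisets, over all edge subsets, of the
  multisets of component marks. The member with all dots zero gives the multiset of all weights. In
  the members with exactly two components, the marks without dots give the leaf weights; their
  number tells a star, which is then determined, from a proper 2-star. For a proper 2-star the
  weights \<open>a\<close>, \<open>b\<close> of the two centers are now known, and so is the contribution of the edge sets that contain
  the central edge, as it depends only on \<open>a + b\<close> and the leaf weights. Subtract it. If \<open>a \<noteq> b\<close>, the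
  remaining sets with one edge give the weights of the end points of each edge, which tells
  how the leaves are distributed. If \<open>a = b\<close>, take among the remaining sets with a single
  nontrivial component one with the largest such component: this component is a center with all
  its leaves, and the isolated vertices are the other center and its leaves.\<close>

section \<open>From the polynomial to multisets of component marks\<close>

definition component_marks :: "'a set \<Rightarrow> ('a \<Rightarrow> mark) \<Rightarrow> 'a set set \<Rightarrow> mark multiset" where
  "component_marks V m A = image_mset (dot_sum m) (mset_set (graph_components V A))"

definition monomial_of :: "mark multiset \<Rightarrow> (mark \<Rightarrow>\<^sub>0 nat)" where
  "monomial_of K = (\<Sum>p\<in>#K. Poly_Mapping.single p 1)"

lemma lookup_monomial_of: "Poly_Mapping.lookup (monomial_of K) p = count K p"
  by (induction K) (auto simp: monomial_of_def lookup_add lookup_single when_def)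

lemma inj_monomial_of: "inj monomial_of"
  by (rule injI) (metis lookup_monomial_of multiset_eqI)

lemma prod_zvar:
  "finite \<C> \<Longrightarrow> (\<Prod>C\<in>\<C>. zvar (h C)) =
    Poly_Mapping.single (monomial_of (image_mset h (mset_set \<C>))) 1"
proof (induction \<C> rule: finite_induct)
  case empty
  show ?case by (simp add: monomial_of_def)
next
  case (insert C \<C>)
  then show ?case by (simp add: zvar_def mult_single monomial_of_def)
qed

lemma finite_graph_components: "finite V \<Longrightarrow> finite (graph_components V A)"
  unfolding graph_components_def quotient_def by auto

lemma lookup_sum_single:
  "finite I \<Longrightarrow> Poly_Mapping.lookup (\<Sum>i\<in>I. Poly_Mapping.single (g i) (1::int)) k =
    int (count (image_mset g (mset_set I)) k)"
  by (induction I rule: finite_induct) (auto simp: lookup_add lookup_single when_def)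

lemma M_poly_eq_sum_single:
  assumes "finite V"
  shows "M_poly V E m = (\<Sum>A\<in>Pow E. Poly_Mapping.single (monomial_of (component_marks V m A)) 1)"
  unfolding M_poly_def component_marks_def
  by (simp add: prod_zvar finite_graph_components assms)

text \<open>The coefficient of a monomial counts the edge sets whose component marks form that
  monomial. Since \<open>monomial_of\<close> is injective, passing to the polynomial loses nothing
  of the multiset.\<close>

lemma M_poly_eq_imp_component_marks_eq:
  assumes "finite V" "finite E" "finite V'" "finite E'" "M_poly V E m = M_poly V' E' m'"
  shows "image_mset (component_marks V m) (mset_set (Pow E)) =
    image_mset (component_marks V' m') (mset_set (Pow E'))"
proof -
  have "count (image_mset (\<lambda>A. monomial_of (component_marks V m A)) (mset_set (Pow E))) k =
     count (image_mset (\<lambda>A. monomial_of (component_marks V' m' A)) (mset_set (Pow E'))) k" for k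
    using arg_cong[OF assms(5), of "\<lambda>P. Poly_Mapping.lookup P k"] assms(1-4)
    by (simp add: M_poly_eq_sum_single lookup_sum_single del: count_image_mset)
  then have "image_mset monomial_of (image_mset (component_marks V m) (mset_set (Pow E))) =
     image_mset monomial_of (image_mset (component_marks V' m') (mset_set (Pow E')))"
    by (simp add: multiset_eq_iff multiset.map_comp comp_def del: count_image_mset)
  then show ?thesis
    using multiset.inj_map[OF inj_monomial_of] by (auto dest: injD)
qed

section \<open>Connected components of edge sets in a 2-star\<close>

text \<open>No path leaves a block that is closed under the edges of \<open>A\<close>, and a hub
  that reaches its whole block makes it connected, so each block is exactly one component. The hub
  also makes the block nonempty. Below, the hubs are centers and isolated leaves.\<close>

lemma graph_components_eqI:
  assumes cover: "\<Union>P = V"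
    and disj: "\<And>B C. B \<in> P \<Longrightarrow> C \<in> P \<Longrightarrow> B \<inter> C \<noteq> {} \<Longrightarrow> B = C"
    and edges: "\<And>x y B. {x, y} \<in> A \<Longrightarrow> B \<in> P \<Longrightarrow> x \<in> B \<Longrightarrow> y \<in> B"
    and hub: "\<And>B. B \<in> P \<Longrightarrow> \<exists>h\<in>B. \<forall>v\<in>B. (h, v) \<in> {(x, y). {x, y} \<in> A}\<^sup>*"
  shows "graph_components V A = P"
proof -
  let ?r = "{(x, y). {x, y} \<in> A}"
  have sym: "sym (?r\<^sup>*)"
    by (rule sym_rtrancl) (auto simp: sym_def insert_commute)
  have stay: "y \<in> B" if "(x, y) \<in> ?r\<^sup>*" "B \<in> P" "x \<in> B" for x y B
    using that by (induction rule: rtrancl_induct) (auto intro: edges)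
  have conn: "(x, y) \<in> ?r\<^sup>*" if "B \<in> P" "x \<in> B" "y \<in> B" for x y B
    using hub[OF that(1)] that(2,3) sym by (meson rtrancl_trans symD)
  have cls: "joined V A `` {x} = B" if "B \<in> P" "x \<in> B" for x B
    using that stay conn cover unfolding joined_def by blast
  have ne: "B \<noteq> {}" if "B \<in> P" for B using hub[OF that] by auto
  show ?thesis
  proof
    show "graph_components V A \<subseteq> P"
      using cover cls unfolding graph_components_def quotient_def by auto
    show "P \<subseteq> graph_components V A"
    proof
      fix B assume "B \<in> P"
      then obtain x where "x \<in> B" using ne by auto
      then show "B \<in> graph_components V A"
        using cls[OF \<open>B \<in> P\<close> \<open>x \<in> B\<close>] cover \<open>B \<in> P\<close>
        unfolding graph_components_def quotient_def by blast
    qed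
  qed
qed

text \<open>Each edge other than \<open>{c, d}\<close> is indexed by its leaf, so an edge set
  amounts to a subset of \<open>X \<union> Y\<close> and the decision whether to include the central
  edge. Stars are covered, as \<open>X\<close> or \<open>Y\<close> may be empty.\<close>

definition double_star :: "'a set \<Rightarrow> 'a set set \<Rightarrow> 'a \<Rightarrow> 'a set \<Rightarrow> 'a \<Rightarrow> 'a set \<Rightarrow> bool" where
  "double_star V E c X d Y \<longleftrightarrow>
     finite X \<and> finite Y \<and> X \<inter> Y = {} \<and> c \<noteq> d \<and> {c, d} \<inter> (X \<union> Y) = {} \<and>
     V = {c, d} \<union> X \<union> Y \<and>
     E = insert {c, d} ((\<lambda>x. {if x \<in> X then c else d, x}) ` (X \<union> Y))"

lemma two_star_imp_double_star:
  assumes "two_star V E"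
  obtains c X d Y where "double_star V E c X d Y"
proof -
  obtain V1 E1 c V2 E2 d where st: "star V1 E1 c" "star V2 E2 d" "V1 \<inter> V2 = {}"
    "V = V1 \<union> V2" "E = insert {c, d} (E1 \<union> E2)"
    using assms unfolding two_star_def by blast
  have "(\<lambda>x. {if x \<in> V1 - {c} then c else d, x}) ` (V1 - {c} \<union> (V2 - {d})) =
     (\<lambda>v. {c, v}) ` (V1 - {c}) \<union> (\<lambda>v. {d, v}) ` (V2 - {d})"
    unfolding image_Un using st(3) by (intro arg_cong2[where f="(\<union>)"] image_cong) auto
  then have E: "E = insert {c, d} ((\<lambda>x. {if x \<in> V1 - {c} then c else d, x}) ` (V1 - {c} \<union> (V2 - {d})))"
    using st(1,2) unfolding st(5) star_def by simp
  have "double_star V E c (V1 - {c}) d (V2 - {d})"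
    unfolding double_star_def by (intro conjI E) (use st(1-4) in \<open>auto simp: star_def\<close>)
  then show thesis by (rule that)
qed

lemma double_star_commute:
  assumes "double_star V E c X d Y"
  shows "double_star V E d Y c X"
proof -
  have "(\<lambda>x. {if x \<in> X then c else d, x}) ` (X \<union> Y) = (\<lambda>x. {if x \<in> Y then d else c, x}) ` (Y \<union> X)"
    using assms unfolding double_star_def by (intro image_cong) auto
  then show ?thesis
    using assms unfolding double_star_def by auto
qed

text \<open>These are the marks of isolated vertices; at the same time they encode the multiset of
  weights on \<open>X\<close>.\<close>

definition unit_marks :: "('a \<Rightarrow> nat) \<Rightarrow> 'a set \<Rightarrow> mark multiset" where
  "unit_marks \<omega> X = image_mset (\<lambda>x. (\<omega> x, 0)) (mset_set X)"

text \<open>The component marks of an edge set that joins exactly the leaves in \<open>S\<close> to their center: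
  \<open>split_marks\<close> if it omits the central edge, \<open>fused_marks\<close> if it contains it.\<close>

definition split_marks :: "('a \<Rightarrow> nat) \<Rightarrow> nat \<Rightarrow> 'a set \<Rightarrow> nat \<Rightarrow> 'a set \<Rightarrow> 'a set \<Rightarrow> mark multiset" where
  "split_marks \<omega> a X b Y S = unit_marks \<omega> (X \<union> Y - S) +
     {#(a + sum \<omega> (S \<inter> X), card (S \<inter> X)), (b + sum \<omega> (S \<inter> Y), card (S \<inter> Y))#}"

definition fused_marks :: "('a \<Rightarrow> nat) \<Rightarrow> nat \<Rightarrow> 'a set \<Rightarrow> 'a set \<Rightarrow> mark multiset" where
  "fused_marks \<omega> a X S = unit_marks \<omega> (X - S) + {#(a + sum \<omega> S, card S + 1)#}"

lemma dot_sum_marked_version: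
  assumes "finite C" "C \<noteq> {}"
  shows "dot_sum (marked_version \<omega>) C = (sum \<omega> C, card C - 1)"
  using dot_sum_closed_form[OF assms, of "marked_version \<omega>"] by (simp add: marked_version_def)

lemma unit_marks_components:
  "image_mset (dot_sum (marked_version \<omega>)) (mset_set ((\<lambda>x. {x}) ` Z)) = unit_marks \<omega> Z"
proof -
  have "mset_set ((\<lambda>x. {x}) ` Z) = image_mset (\<lambda>x. {x}) (mset_set Z)"
    by (rule image_mset_mset_set[symmetric]) auto
  then show ?thesis
    by (simp add: multiset.map_comp comp_def unit_marks_def dot_sum_singleton marked_version_def)
qed

text \<open>The components are each center with its chosen leaves and the remaining leaves one by
  one. A center with k chosen leaves spans k + 1 vertices, hence carries k dots.\<close>

lemma component_marks_split:
  assumes ds: "double_star V E c X d Y" and S: "S \<subseteq> X \<union> Y"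
  shows "component_marks V (marked_version \<omega>) ((\<lambda>x. {if x \<in> X then c else d, x}) ` S) =
    split_marks \<omega> (\<omega> c) X (\<omega> d) Y S"
proof -
  let ?A = "(\<lambda>x. {if x \<in> X then c else d, x}) ` S"
  let ?P = "insert (insert c (S \<inter> X)) (insert (insert d (S \<inter> Y)) ((\<lambda>x. {x}) ` (X \<union> Y - S)))"
  have fin: "finite X" "finite Y" "finite S"
    using ds S finite_subset unfolding double_star_def by auto
  have sep: "c \<noteq> d" "c \<notin> X" "c \<notin> Y" "d \<notin> X" "d \<notin> Y" "X \<inter> Y = {}" "V = {c, d} \<union> X \<union> Y"
    using ds unfolding double_star_def by auto
  have "graph_components V ?A = ?P"
  proof (rule graph_components_eqI)
    show "\<Union>?P = V" using sep S by auto
    show "B = C" if "B \<in> ?P" "C \<in> ?P" "B \<inter> C \<noteq> {}" for B C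
      using that sep S by auto
    show "y \<in> B" if "{x, y} \<in> ?A" "B \<in> ?P" "x \<in> B" for x y B
      using that sep S by (auto simp: doubleton_eq_iff split: if_splits)
    show "\<exists>h\<in>B. \<forall>v\<in>B. (h, v) \<in> {(x, y). {x, y} \<in> ?A}\<^sup>*" if "B \<in> ?P" for B
    proof -
      consider "B = insert c (S \<inter> X)" | "B = insert d (S \<inter> Y)" | x where "B = {x}"
        using \<open>B \<in> ?P\<close> by auto
      then show ?thesis
      proof cases
        case 1
        have "(c, v) \<in> {(x, y). {x, y} \<in> ?A}" if "v \<in> S \<inter> X" for v
          using that by (simp add: image_iff) (use that in force)
        then show ?thesis unfolding 1 by (intro bexI[of _ c]) blast+
      next
        case 2
        have "(d, v) \<in> {(x, y). {x, y} \<in> ?A}" if "v \<in> S \<inter> Y" for v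
        proof -
          have "v \<notin> X" using that sep by auto
          then show ?thesis using that by (simp add: image_iff) (use \<open>v \<notin> X\<close> in force)
        qed
        then show ?thesis unfolding 2 by (intro bexI[of _ d]) blast+
      qed auto
    qed
  qed
  \<comment> \<open>The blocks are distinct as sets, so \<open>mset_set\<close> counts each of them
    separately even if some of their marks coincide.\<close>
  moreover have "insert c (S \<inter> X) \<notin> insert (insert d (S \<inter> Y)) ((\<lambda>x. {x}) ` (X \<union> Y - S))"
    "insert d (S \<inter> Y) \<notin> (\<lambda>x. {x}) ` (X \<union> Y - S)"
    using sep by auto
  ultimately show ?thesis
    using fin sep S
    by (simp add: component_marks_def split_marks_def unit_marks_components
        dot_sum_marked_version)
qed

text \<open>The central edge merges both centers and all of \<open>S\<close> into one component with
  \<open>card S + 2\<close> vertices, hence \<open>card S + 1\<close> dots; the side on which a leaf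
  hangs no longer matters.\<close>

lemma component_marks_fused:
  assumes ds: "double_star V E c X d Y" and S: "S \<subseteq> X \<union> Y"
  shows "component_marks V (marked_version \<omega>)
      (insert {c, d} ((\<lambda>x. {if x \<in> X then c else d, x}) ` S)) =
    fused_marks \<omega> (\<omega> c + \<omega> d) (X \<union> Y) S"
proof -
  let ?A = "insert {c, d} ((\<lambda>x. {if x \<in> X then c else d, x}) ` S)"
  let ?P = "insert (insert c (insert d S)) ((\<lambda>x. {x}) ` (X \<union> Y - S))"
  let ?r = "{(x, y). {x, y} \<in> ?A}"
  have fin: "finite X" "finite Y" "finite S"
    using ds S finite_subset unfolding double_star_def by auto
  have sep: "c \<noteq> d" "c \<notin> X" "c \<notin> Y" "d \<notin> X" "d \<notin> Y" "X \<inter> Y = {}" "V = {c, d} \<union> X \<union> Y"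
    using ds unfolding double_star_def by auto
  have "graph_components V ?A = ?P"
  proof (rule graph_components_eqI)
    show "\<Union>?P = V" using sep S by auto
    show "B = C" if "B \<in> ?P" "C \<in> ?P" "B \<inter> C \<noteq> {}" for B C
      using that sep S by auto
    show "y \<in> B" if "{x, y} \<in> ?A" "B \<in> ?P" "x \<in> B" for x y B
      using that sep S by (auto simp: doubleton_eq_iff split: if_splits)
    show "\<exists>h\<in>B. \<forall>v\<in>B. (h, v) \<in> ?r\<^sup>*" if "B \<in> ?P" for B
    proof -
      consider "B = insert c (insert d S)" | x where "B = {x}"
        using \<open>B \<in> ?P\<close> by auto
      then show ?thesis
      proof cases
        case 1
        have cd: "(c, d) \<in> ?r\<^sup>*" by (auto intro: r_into_rtrancl)
        have "(c, v) \<in> ?r\<^sup>*" if "v \<in> S" for v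
        proof -
          have "(if v \<in> X then c else d, v) \<in> ?r" using that by auto
          moreover have "(c, if v \<in> X then c else d) \<in> ?r\<^sup>*" using cd by simp
          ultimately show ?thesis by (rule rtrancl_into_rtrancl[rotated])
        qed
        then show ?thesis using 1 cd by auto
      qed auto
    qed
  qed
  moreover have "insert c (insert d S) \<notin> (\<lambda>x. {x}) ` (X \<union> Y - S)"
    using sep by auto
  moreover have "c \<notin> S" "d \<notin> S" using sep S by auto
  ultimately show ?thesis
    using fin sep(1)
    by (simp add: component_marks_def fused_marks_def unit_marks_components
        dot_sum_marked_version add.assoc)
qed

definition double_star_marks :: "('a \<Rightarrow> nat) \<Rightarrow> nat \<Rightarrow> 'a set \<Rightarrow> nat \<Rightarrow> 'a set \<Rightarrow> mark multiset multiset" where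
  "double_star_marks \<omega> a X b Y =
     image_mset (split_marks \<omega> a X b Y) (mset_set (Pow (X \<union> Y))) +
     image_mset (fused_marks \<omega> (a + b) (X \<union> Y)) (mset_set (Pow (X \<union> Y)))"

text \<open>Distinct leaves have distinct edges, none of them the central one. Hence
  \<open>Pow E\<close> consists of two disjoint copies of \<open>Pow (X \<union> Y)\<close>, without
  and with the central edge.\<close>

lemma component_marks_double_star:
  assumes ds: "double_star V E c X d Y"
  shows "image_mset (component_marks V (marked_version \<omega>)) (mset_set (Pow E)) =
    double_star_marks \<omega> (\<omega> c) X (\<omega> d) Y"
proof -
  let ?e = "\<lambda>x. {if x \<in> X then c else d, x}"
  let ?g = "component_marks V (marked_version \<omega>)"
  have fin: "finite (X \<union> Y)" using ds unfolding double_star_def by auto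
  have sep: "c \<noteq> d" "c \<notin> X" "c \<notin> Y" "d \<notin> X" "d \<notin> Y" "X \<inter> Y = {}"
    and E: "E = insert {c, d} (?e ` (X \<union> Y))"
    using ds unfolding double_star_def by auto
  have "inj_on ?e (X \<union> Y)"
    using sep by (auto simp: inj_on_def doubleton_eq_iff)
  then have inj: "inj_on ((`) ?e) (Pow (X \<union> Y))"
    by (rule inj_on_image_Pow)
  have notin: "{c, d} \<notin> ?e ` (X \<union> Y)"
    using sep by (auto simp: doubleton_eq_iff split: if_splits)
  have notin_sub: "{c, d} \<notin> B" if "B \<in> (`) ?e ` Pow (X \<union> Y)" for B
    using that notin unfolding image_Pow_surj[OF refl] by (metis PowD subsetD)
  have inj2: "inj_on (insert {c, d}) ((`) ?e ` Pow (X \<union> Y))"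
    by (rule inj_onI) (simp only: insert_ident[OF notin_sub notin_sub])
  have "Pow E = (`) ?e ` Pow (X \<union> Y) \<union> insert {c, d} ` (`) ?e ` Pow (X \<union> Y)"
    unfolding E Pow_insert image_Pow_surj[OF refl] ..
  moreover have "(`) ?e ` Pow (X \<union> Y) \<inter> insert {c, d} ` (`) ?e ` Pow (X \<union> Y) = {}"
    by (rule equals0I, elim IntE, drule notin_sub, erule imageE, simp)
  ultimately have "mset_set (Pow E) = image_mset ((`) ?e) (mset_set (Pow (X \<union> Y))) +
      image_mset (insert {c, d}) (image_mset ((`) ?e) (mset_set (Pow (X \<union> Y))))"
    unfolding image_mset_mset_set[OF inj] image_mset_mset_set[OF inj2]
    using fin by (simp only: mset_set_Union finite_imageI finite_Pow_iff)
  then have "image_mset ?g (mset_set (Pow E)) =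
     image_mset (\<lambda>S. ?g (?e ` S)) (mset_set (Pow (X \<union> Y))) +
     image_mset (\<lambda>S. ?g (insert {c, d} (?e ` S))) (mset_set (Pow (X \<union> Y)))"
    by (simp add: multiset.map_comp comp_def)
  also have "\<dots> = double_star_marks \<omega> (\<omega> c) X (\<omega> d) Y"
    unfolding double_star_marks_def using fin
    by (intro arg_cong2[where f="(+)"] image_mset_cong)
       (simp_all add: component_marks_split[OF ds] component_marks_fused[OF ds])
  finally show ?thesis .
qed

section \<open>Dotless marks and weight-preserving bijections\<close>

lemma size_unit_marks [simp]: "finite Z \<Longrightarrow> size (unit_marks \<omega> Z) = card Z"
  by (simp add: unit_marks_def)

lemma snd_unit_marks: "p \<in># unit_marks \<omega> Z \<Longrightarrow> snd p = 0"
  by (cases "finite Z") (auto simp: unit_marks_def)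

lemma filter_unit_marks [simp]:
  "filter_mset (\<lambda>p. snd p = 0) (unit_marks \<omega> Z) = unit_marks \<omega> Z"
  "filter_mset (\<lambda>p. 0 < snd p) (unit_marks \<omega> Z) = {#}"
proof -
  show "filter_mset (\<lambda>p. snd p = 0) (unit_marks \<omega> Z) = unit_marks \<omega> Z"
    by (auto simp: filter_mset_eq_conv dest: snd_unit_marks)
  show "filter_mset (\<lambda>p. 0 < snd p) (unit_marks \<omega> Z) = {#}"
    by (auto simp: filter_mset_eq_conv dest: snd_unit_marks)
qed

lemma unit_marks_Un:
  "finite X \<Longrightarrow> finite Y \<Longrightarrow> X \<inter> Y = {} \<Longrightarrow> unit_marks \<omega> (X \<union> Y) = unit_marks \<omega> X + unit_marks \<omega> Y"
  by (simp add: unit_marks_def mset_set_Union)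

lemma unit_marks_remove:
  "finite X \<Longrightarrow> x \<in> X \<Longrightarrow> unit_marks \<omega> X = add_mset (\<omega> x, 0) (unit_marks \<omega> (X - {x}))"
  by (simp add: unit_marks_def mset_set.remove)

lemma unit_marks_cong_bij:
  assumes "bij_betw g X X'" "\<And>x. x \<in> X \<Longrightarrow> \<omega>' (g x) = \<omega> x"
  shows "unit_marks \<omega> X = unit_marks \<omega>' X'"
proof -
  have "mset_set X' = image_mset g (mset_set X)"
    using assms(1) by (simp add: bij_betw_def image_mset_mset_set)
  then show ?thesis
    using assms(2) by (cases "finite X") (auto simp: unit_marks_def multiset.map_comp comp_def intro!: image_mset_cong)
qed

text \<open>Vertices are matched one at a time: \<open>x\<close> is paired with any vertex of the
  same weight, and both are removed. This is how equal multisets of weights become maps between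
  vertex sets.\<close>

lemma unit_marks_eq_imp_bij:
  assumes "finite X" "finite X'" "unit_marks \<omega> X = unit_marks \<omega>' X'"
  obtains g where "bij_betw g X X'" "\<And>x. x \<in> X \<Longrightarrow> \<omega>' (g x) = \<omega> x"
proof -
  have "\<exists>g. bij_betw g X X' \<and> (\<forall>x\<in>X. \<omega>' (g x) = \<omega> x)"
    using assms
  proof (induction X arbitrary: X' rule: finite_induct)
    case empty
    then have "X' = {}" by (simp add: unit_marks_def mset_set_empty_iff)
    then show ?case by (simp add: bij_betw_def)
  next
    case (insert x X)
    have "(\<omega> x, 0) \<in># unit_marks \<omega>' X'"
      using insert by (metis finite_insert insertI1 unit_marks_remove union_single_eq_member)
    then obtain x' where x': "x' \<in> X'" "\<omega>' x' = \<omega> x"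
      using \<open>finite X'\<close> by (auto simp: unit_marks_def)
    have "unit_marks \<omega> X = unit_marks \<omega>' (X' - {x'})"
      using insert.prems insert.hyps x' unit_marks_remove[of "insert x X" x \<omega>]
        unit_marks_remove[of X' x' \<omega>'] by simp
    then obtain g where g: "bij_betw g X (X' - {x'})" "\<forall>y\<in>X. \<omega>' (g y) = \<omega> y"
      using insert.IH[of "X' - {x'}"] insert.prems by auto
    have "bij_betw (g(x := x')) X (X' - {x'})"
      using g(1) insert.hyps by (subst bij_betw_cong[of _ _ g]) auto
    then have "bij_betw (g(x := x')) (insert x X) (insert x' (X' - {x'}))"
      using insert.hyps by (intro bij_betw_combine[of _ X _ "{x}" "{x'}", simplified]) auto
    then show ?case using g x' insert.hyps by (intro exI[of _ "g(x := x')"]) (auto simp: insert_absorb simp del: fun_upd_apply, auto)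
  qed
  then show thesis using that by blast
qed

lemma fused_marks_cong:
  assumes "finite X" "finite X'" "unit_marks \<omega> X = unit_marks \<omega>' X'"
  shows "image_mset (fused_marks \<omega> a X) (mset_set (Pow X)) =
    image_mset (fused_marks \<omega>' a X') (mset_set (Pow X'))"
proof -
  obtain g where g: "bij_betw g X X'" and w: "\<And>x. x \<in> X \<Longrightarrow> \<omega>' (g x) = \<omega> x"
    using unit_marks_eq_imp_bij[OF assms] by blast
  have "mset_set (Pow X') = image_mset ((`) g) (mset_set (Pow X))"
    using bij_betw_Pow[OF g] by (simp add: bij_betw_def image_mset_mset_set)
  moreover have "fused_marks \<omega> a X S = fused_marks \<omega>' a X' (g ` S)" if "S \<subseteq> X" for S
  proof -
    have "bij_betw g (X - S) (X' - g ` S)"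
      using g that by (auto simp: bij_betw_def inj_on_def)
    then have "unit_marks \<omega> (X - S) = unit_marks \<omega>' (X' - g ` S)"
      using w by (intro unit_marks_cong_bij) auto
    moreover have inj: "inj_on g S" using g that by (auto simp: bij_betw_def inj_on_subset)
    moreover have "sum \<omega>' (g ` S) = sum \<omega> S"
      using inj w that by (subst sum.reindex) (auto intro!: sum.cong)
    ultimately show ?thesis by (simp add: fused_marks_def card_image)
  qed
  ultimately show ?thesis
    using assms(1) by (simp add: multiset.map_comp comp_def) (auto intro!: image_mset_cong)
qed

section \<open>Recovering all weights and the leaf weights\<close>

text \<open>Every chosen edge, central or not, puts a dot on some component, so a member without
  dots comes from the empty edge set.\<close>

lemma weights_in_double_star_marks:
  assumes "finite X" "finite Y"
    and "t \<in># double_star_marks \<omega> a X b Y" "\<And>p. p \<in># t \<Longrightarrow> snd p = 0"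
  shows "t = unit_marks \<omega> (X \<union> Y) + {#(a, 0), (b, 0)#}"
proof -
  from assms(3) consider S where "S \<subseteq> X \<union> Y" "t = split_marks \<omega> a X b Y S"
    | S where "t = fused_marks \<omega> (a + b) (X \<union> Y) S"
    using assms(1,2) by (auto simp: double_star_marks_def)
  then show ?thesis
  proof cases
    case 1
    then have "card (S \<inter> X) = 0" "card (S \<inter> Y) = 0"
      using assms(4)[of "(a + sum \<omega> (S \<inter> X), card (S \<inter> X))"]
        assms(4)[of "(b + sum \<omega> (S \<inter> Y), card (S \<inter> Y))"] by (auto simp: split_marks_def)
    then have "S = {}" using assms(1,2) 1(1) by auto
    then show ?thesis using 1 by (simp add: split_marks_def)
  next
    case 2
    then have False
      using assms(4)[of "(a + b + sum \<omega> S, card S + 1)"] by (simp add: fused_marks_def)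
    then show ?thesis ..
  qed
qed

lemma double_star_marks_eq_imp_weights_eq:
  assumes "finite X" "finite Y" "finite X'" "finite Y'"
    and "double_star_marks \<omega> a X b Y = double_star_marks \<omega>' a' X' b' Y'"
  shows "unit_marks \<omega> (X \<union> Y) + {#(a, 0), (b, 0)#} = unit_marks \<omega>' (X' \<union> Y') + {#(a', 0), (b', 0)#}"
proof -
  let ?t = "unit_marks \<omega> (X \<union> Y) + {#(a, 0), (b, 0)#}"
  have "?t = split_marks \<omega> a X b Y {}" by (simp add: split_marks_def)
  then have "?t \<in># double_star_marks \<omega> a X b Y"
    using assms(1,2) by (simp add: double_star_marks_def)
  then have "?t \<in># double_star_marks \<omega>' a' X' b' Y'"
    using assms(5) by simp
  moreover have "snd p = 0" if "p \<in># ?t" for p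
    using that by (auto dest: snd_unit_marks)
  ultimately show ?thesis using weights_in_double_star_marks[OF assms(3,4)] by blast
qed

text \<open>Two components arise by deleting a single edge of the tree. Deleting a leaf edge leaves
  that leaf as the only dotless component, provided the rest keeps an edge.\<close>

definition leaf_marks :: "mark multiset multiset \<Rightarrow> mark multiset" where
  "leaf_marks M = (\<Sum>t\<in>#filter_mset (\<lambda>t. size t = 2) M. filter_mset (\<lambda>p. snd p = 0) t)"

text \<open>Each deleted leaf edge contributes the mark of its leaf. Deleting the central edge
  contributes only the centers that have no leaves, which gives the second summand.\<close>

lemma leaf_marks_double_star:
  assumes "finite X" "finite Y" "X \<inter> Y = {}"
  shows "leaf_marks (double_star_marks \<omega> a X b Y) = unit_marks \<omega> (X \<union> Y) +
    filter_mset (\<lambda>p. snd p = 0) {#(a + sum \<omega> X, card X), (b + sum \<omega> Y, card Y)#}"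
proof -
  let ?Z = "X \<union> Y"
  have fin: "finite ?Z" using assms by simp
  \<comment> \<open>Without the central edge the two centers already lie in two components, so no
    leaf may be isolated.\<close>
  have "size (split_marks \<omega> a X b Y S) = 2 \<longleftrightarrow> S = ?Z" if "S \<subseteq> ?Z" for S
    using that fin by (auto simp: split_marks_def)
  then have 1: "{S \<in> Pow ?Z. size (split_marks \<omega> a X b Y S) = 2} = {?Z}" by auto
  \<comment> \<open>With the central edge both centers lie in one component, so exactly one leaf
    must be isolated.\<close>
  have "{S \<in> Pow ?Z. size (fused_marks \<omega> (a + b) ?Z S) = 2} = {S \<in> Pow ?Z. card (?Z - S) = 1}"
    using fin by (auto simp: fused_marks_def)
  also have "\<dots> = (\<lambda>x. ?Z - {x}) ` ?Z"
  proof (intro equalityI subsetI)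
    fix S assume S: "S \<in> {S \<in> Pow ?Z. card (?Z - S) = 1}"
    then obtain x where "?Z - S = {x}" by (auto simp: card_1_singleton_iff)
    then show "S \<in> (\<lambda>x. ?Z - {x}) ` ?Z" using S by (intro image_eqI[of _ _ x]) auto
  next
    fix S assume "S \<in> (\<lambda>x. ?Z - {x}) ` ?Z"
    then obtain x where "x \<in> ?Z" "S = ?Z - {x}" by blast
    moreover from this have "?Z - S = {x}" by blast
    ultimately show "S \<in> {S \<in> Pow ?Z. card (?Z - S) = 1}" by auto
  qed
  finally have 2: "{S \<in> Pow ?Z. size (fused_marks \<omega> (a + b) ?Z S) = 2} = (\<lambda>x. ?Z - {x}) ` ?Z" .
  have inj: "inj_on (\<lambda>x. ?Z - {x}) ?Z" by (auto simp: inj_on_def)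
  \<comment> \<open>The component of the centers has at least the dot of the central edge and is
    filtered out.\<close>
  have 3: "filter_mset (\<lambda>p. snd p = 0) (fused_marks \<omega> (a + b) ?Z (?Z - {x})) = {#(\<omega> x, 0)#}"
    if "x \<in> ?Z" for x
  proof -
    have "?Z - (?Z - {x}) = {x}" using that by blast
    then show ?thesis by (simp add: fused_marks_def) (simp add: unit_marks_def)
  qed
  have "(\<Sum>t\<in>#filter_mset (\<lambda>t. size t = 2) (image_mset (fused_marks \<omega> (a + b) ?Z) (mset_set (Pow ?Z))).
      filter_mset (\<lambda>p. snd p = 0) t) = (\<Sum>x\<in>#mset_set ?Z. {#(\<omega> x, 0)#})"
    unfolding filter_mset_image_mset filter_mset_mset_set[OF finite_Pow_iff[THEN iffD2, OF fin]] 2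
      image_mset_mset_set[OF inj, symmetric] using fin
    by (auto simp: multiset.map_comp comp_def 3 simp del: sum_mset_singleton_mset
        intro!: arg_cong[where f = sum_mset] image_mset_cong)
  also have "\<dots> = unit_marks \<omega> ?Z" by (simp add: unit_marks_def)
  finally have R: "(\<Sum>t\<in>#filter_mset (\<lambda>t. size t = 2) (image_mset (fused_marks \<omega> (a + b) ?Z) (mset_set (Pow ?Z))).
      filter_mset (\<lambda>p. snd p = 0) t) = unit_marks \<omega> ?Z" .
  have ZX: "?Z \<inter> X = X" "?Z \<inter> Y = Y" by auto
  have "(\<Sum>t\<in>#filter_mset (\<lambda>t. size t = 2) (image_mset (split_marks \<omega> a X b Y) (mset_set (Pow ?Z))).
      filter_mset (\<lambda>p. snd p = 0) t) =
    filter_mset (\<lambda>p. snd p = 0) {#(a + sum \<omega> X, card X), (b + sum \<omega> Y, card Y)#}"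
    unfolding filter_mset_image_mset filter_mset_mset_set[OF finite_Pow_iff[THEN iffD2, OF fin]] 1
    by (simp add: split_marks_def ZX) (simp add: unit_marks_def)
  with R show ?thesis
    by (simp add: leaf_marks_def double_star_marks_def)
qed

section \<open>Distribution of the leaves for different center weights\<close>

text \<open>An edge set with a single edge has one component fewer than there are vertices. Its
  dotless marks are those of the vertices off the edge, so removing them from the multiset
  \<open>W\<close> of all weights leaves the weights of the two end points.\<close>

lemma edge_marks_split:
  fixes \<omega> :: "'a \<Rightarrow> nat" and a b :: nat
  assumes "finite X" "finite Y" "X \<inter> Y = {}"
  defines "W \<equiv> unit_marks \<omega> (X \<union> Y) + {#(a, 0), (b, 0)#}"
  shows "image_mset (\<lambda>t. W - filter_mset (\<lambda>p. snd p = 0) t)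
      (filter_mset (\<lambda>t. size t + 1 = size W)
        (image_mset (split_marks \<omega> a X b Y) (mset_set (Pow (X \<union> Y))))) =
    image_mset (\<lambda>p. {#(a, 0), p#}) (unit_marks \<omega> X) + image_mset (\<lambda>p. {#(b, 0), p#}) (unit_marks \<omega> Y)"
proof -
  let ?Z = "X \<union> Y"
  let ?D = "\<lambda>t. W - filter_mset (\<lambda>p. snd p = 0) t"
  have fin: "finite ?Z" using assms by simp
  \<comment> \<open>Both sides include the two centers, so the condition says that exactly one leaf
    is not isolated.\<close>
  have "size (split_marks \<omega> a X b Y S) + 1 = size W \<longleftrightarrow> card S = 1" if "S \<subseteq> ?Z" for S
  proof -
    have "card (?Z - S) + card S = card ?Z"
      using card_Diff_subset[OF finite_subset[OF that fin] that] card_mono[OF fin that] by simp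
    then show ?thesis using fin by (auto simp: split_marks_def W_def)
  qed
  then have 1: "{S \<in> Pow ?Z. size (split_marks \<omega> a X b Y S) + 1 = size W} = (\<lambda>x. {x}) ` ?Z"
    by (auto simp: card_1_singleton_iff)
  have 2: "?D (split_marks \<omega> a X b Y {x}) = {#(a, 0), (\<omega> x, 0)#}" if "x \<in> X" for x
  proof -
    have "x \<notin> Y" "x \<in> ?Z" using that assms(3) by auto
    then show ?thesis
      using that unit_marks_remove[OF fin, of x \<omega>] by (simp add: split_marks_def W_def)
  qed
  have 3: "?D (split_marks \<omega> a X b Y {x}) = {#(b, 0), (\<omega> x, 0)#}" if "x \<in> Y" for x
  proof -
    have "x \<notin> X" "x \<in> ?Z" using that assms(3) by auto
    then show ?thesis
      using that unit_marks_remove[OF fin, of x \<omega>] by (simp add: split_marks_def W_def)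
  qed
  have inj: "inj_on (\<lambda>x. {x}) ?Z" by simp
  have "image_mset ?D (filter_mset (\<lambda>t. size t + 1 = size W)
      (image_mset (split_marks \<omega> a X b Y) (mset_set (Pow ?Z)))) =
    image_mset (\<lambda>x. ?D (split_marks \<omega> a X b Y {x})) (mset_set ?Z)"
    unfolding filter_mset_image_mset filter_mset_mset_set[OF finite_Pow_iff[THEN iffD2, OF fin]] 1
      image_mset_mset_set[OF inj, symmetric] by (simp add: multiset.map_comp comp_def)
  also have "\<dots> = image_mset (\<lambda>x. {#(a, 0), (\<omega> x, 0)#}) (mset_set X) +
      image_mset (\<lambda>x. {#(b, 0), (\<omega> x, 0)#}) (mset_set Y)"
    unfolding mset_set_Union[OF assms(1-3)] image_mset_union using assms(1,2) 2 3
    by (intro arg_cong2[where f="(+)"] image_mset_cong) auto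
  finally show ?thesis by (simp add: unit_marks_def multiset.map_comp comp_def)
qed

lemma count_edge_marks: "count (image_mset (\<lambda>p. {#q, p#}) L) {#q, r#} = count L r"
  by (induction L) auto

lemma count_edge_marks_0:
  assumes "s \<noteq> q" "r \<noteq> q"
  shows "count (image_mset (\<lambda>p. {#q, p#}) L) {#s, r#} = 0"
proof -
  have "{#q, p#} \<noteq> {#s, r#}" for p
  proof
    assume "{#q, p#} = {#s, r#}"
    then have "q \<in># {#s, r#}" by (metis union_single_eq_member)
    then show False using assms by simp
  qed
  then show ?thesis by (induction L) auto
qed

text \<open>For \<open>r \<noteq> q\<close> the pair \<open>{#p, r#}\<close> can only come from the
  first family, so its count is that of \<open>r\<close> in \<open>K\<close>. The pair
  \<open>{#p, q#}\<close> is ambiguous; instead \<open>{#q, q#}\<close> gives the count of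
  \<open>q\<close> in \<open>L\<close>, and the known total gives its count in
  \<open>K\<close>.\<close>

lemma edge_marks_determine:
  assumes "p \<noteq> q" and sum: "K + L = K' + L'"
    and edges: "image_mset (\<lambda>x. {#p, x#}) K + image_mset (\<lambda>x. {#q, x#}) L =
      image_mset (\<lambda>x. {#p, x#}) K' + image_mset (\<lambda>x. {#q, x#}) L'"
  shows "K = K' \<and> L = L'"
proof -
  have cnt: "count (image_mset (\<lambda>x. {#p, x#}) K) e + count (image_mset (\<lambda>x. {#q, x#}) L) e =
      count (image_mset (\<lambda>x. {#p, x#}) K') e + count (image_mset (\<lambda>x. {#q, x#}) L') e" for e
    using arg_cong[OF edges, of "\<lambda>M. count M e"] by simp
  have tot: "count K r + count L r = count K' r + count L' r" for r
    using arg_cong[OF sum, of "\<lambda>M. count M r"] by simp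
  have "count K r = count K' r" for r
  proof (cases "r = q")
    case True
    have "count L q = count L' q"
      using cnt[of "{#q, q#}"] assms(1) by (simp add: count_edge_marks count_edge_marks_0 del: count_image_mset)
    then show ?thesis using tot[of q] True by simp
  next
    case False
    then show ?thesis
      using cnt[of "{#p, r#}"] assms(1) by (simp add: count_edge_marks count_edge_marks_0 del: count_image_mset)
  qed
  then have "K = K'" by (rule multiset_eqI)
  then show ?thesis using sum by simp
qed

section \<open>Distribution of the leaves for equal center weights\<close>

text \<open>The left member has exactly one mark with dots, so on the right only one center is
  joined to leaves, and the number of dots gives \<open>card S\<close>. Among the dotless marks the
  bare center has weight \<open>a\<close> on both sides, whichever center it is; cancelling it
  leaves the isolated leaves.\<close>

lemma split_marks_eq_full_side:
  assumes fin: "finite X" "finite Y" "finite X'" "finite Y'"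
    and disj: "X \<inter> Y = {}" "X' \<inter> Y' = {}"
    and "X \<noteq> {}"
    and eq: "split_marks \<omega> a X a Y X = split_marks \<omega>' a X' a Y' S" and S: "S \<subseteq> X' \<union> Y'"
  shows "(S \<subseteq> X' \<or> S \<subseteq> Y') \<and> card S = card X \<and> unit_marks \<omega> Y = unit_marks \<omega>' (X' \<union> Y' - S)"
proof -
  have "X \<inter> Y = {}" "X \<union> Y - X = Y" using disj by auto
  then have t: "split_marks \<omega> a X a Y X = unit_marks \<omega> Y + {#(a + sum \<omega> X, card X), (a, 0)#}"
    by (simp add: split_marks_def)
  have finS: "finite S" using S fin finite_subset by auto
  have cX: "card X > 0" using assms(7) fin by (simp add: card_gt_0_iff)
  from arg_cong[OF eq, of "filter_mset (\<lambda>p. 0 < snd p)"]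
  have pos: "{#(a + sum \<omega> X, card X)#} = filter_mset (\<lambda>p. 0 < snd p)
      {#(a + sum \<omega>' (S \<inter> X'), card (S \<inter> X')), (a + sum \<omega>' (S \<inter> Y'), card (S \<inter> Y'))#}"
    unfolding t using cX by (simp add: split_marks_def)
  from arg_cong[OF eq, of "filter_mset (\<lambda>p. snd p = 0)"]
  have zero: "add_mset (a, 0) (unit_marks \<omega> Y) = unit_marks \<omega>' (X' \<union> Y' - S) + filter_mset (\<lambda>p. snd p = 0)
      {#(a + sum \<omega>' (S \<inter> X'), card (S \<inter> X')), (a + sum \<omega>' (S \<inter> Y'), card (S \<inter> Y'))#}"
    unfolding t using cX by (simp add: split_marks_def)
  have "S \<inter> X' = {} \<or> S \<inter> Y' = {}"
  proof (rule ccontr)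
    assume "\<not> ?thesis"
    then have "card (S \<inter> X') > 0" "card (S \<inter> Y') > 0" using finS by (auto simp: card_gt_0_iff)
    then show False using arg_cong[OF pos, of size] by simp
  qed
  then consider "S \<inter> X' = {}" "S \<inter> Y' = S" | "S \<inter> Y' = {}" "S \<inter> X' = S" using S by blast
  then show ?thesis
  proof cases
    case 1
    then have "S \<noteq> {}" using pos by auto
    then have "card S > 0" using finS by (simp add: card_gt_0_iff)
    then show ?thesis using 1 pos zero by auto
  next
    case 2
    then have "S \<noteq> {}" using pos by auto
    then have "card S > 0" using finS by (simp add: card_gt_0_iff)
    then show ?thesis using 2 pos zero by auto
  qed
qed

lemma split_marks_commute: "split_marks \<omega> a X b Y S = split_marks \<omega> b Y a X S"
  by (simp add: split_marks_def Un_commute add_mset_commute)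

text \<open>The member that joins all of \<open>X\<close> to its center must match a set
  \<open>S\<close> inside one primed leaf set. As \<open>X\<close> is at least as large as that leaf
  set, \<open>S\<close> fills it. The isolated leaves give \<open>Y\<close>, and subtraction from
  all leaves gives \<open>X\<close>.\<close>

lemma split_marks_equal_centers_larger:
  assumes fin: "finite X" "finite Y" "finite X'" "finite Y'"
    and disj: "X \<inter> Y = {}" "X' \<inter> Y' = {}"
    and ne: "X \<noteq> {}"
    and larger: "card X' \<le> card X" "card Y' \<le> card X"
    and leaves: "unit_marks \<omega> (X \<union> Y) = unit_marks \<omega>' (X' \<union> Y')"
    and eq: "image_mset (split_marks \<omega> a X a Y) (mset_set (Pow (X \<union> Y))) =
      image_mset (split_marks \<omega>' a X' a Y') (mset_set (Pow (X' \<union> Y')))"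
  shows "unit_marks \<omega> X = unit_marks \<omega>' X' \<and> unit_marks \<omega> Y = unit_marks \<omega>' Y' \<or>
    unit_marks \<omega> X = unit_marks \<omega>' Y' \<and> unit_marks \<omega> Y = unit_marks \<omega>' X'"
proof -
  have "split_marks \<omega> a X a Y X \<in># image_mset (split_marks \<omega> a X a Y) (mset_set (Pow (X \<union> Y)))"
    using fin by simp
  then obtain S where S: "S \<subseteq> X' \<union> Y'"
    and "split_marks \<omega> a X a Y X = split_marks \<omega>' a X' a Y' S"
    unfolding eq using fin by auto
  from split_marks_eq_full_side[OF fin disj ne this(2,1)]
  have S': "S \<subseteq> X' \<or> S \<subseteq> Y'" "card S = card X" "unit_marks \<omega> Y = unit_marks \<omega>' (X' \<union> Y' - S)"
    by auto
  have L: "unit_marks \<omega> X + unit_marks \<omega> Y = unit_marks \<omega>' X' + unit_marks \<omega>' Y'"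
    using leaves by (simp add: unit_marks_Un fin disj)
  from S'(1) show ?thesis
  proof
    assume "S \<subseteq> X'"
    then have "S = X'" using larger(1) S'(2) fin by (intro card_seteq) auto
    moreover have "X' \<union> Y' - X' = Y'" using disj by auto
    ultimately show ?thesis using S'(3) L by simp
  next
    assume "S \<subseteq> Y'"
    then have "S = Y'" using larger(2) S'(2) fin by (intro card_seteq) auto
    moreover have "X' \<union> Y' - Y' = X'" using disj by auto
    ultimately show ?thesis using S'(3) L by (simp add: add.commute)
  qed
qed

lemma split_marks_equal_centers:
  assumes fin: "finite X" "finite Y" "finite X'" "finite Y'"
    and disj: "X \<inter> Y = {}" "X' \<inter> Y' = {}"
    and ne: "X \<noteq> {}" "Y \<noteq> {}" "X' \<noteq> {}" "Y' \<noteq> {}"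
    and leaves: "unit_marks \<omega> (X \<union> Y) = unit_marks \<omega>' (X' \<union> Y')"
    and eq: "image_mset (split_marks \<omega> a X a Y) (mset_set (Pow (X \<union> Y))) =
      image_mset (split_marks \<omega>' a X' a Y') (mset_set (Pow (X' \<union> Y')))"
  shows "unit_marks \<omega> X = unit_marks \<omega>' X' \<and> unit_marks \<omega> Y = unit_marks \<omega>' Y' \<or>
    unit_marks \<omega> X = unit_marks \<omega>' Y' \<and> unit_marks \<omega> Y = unit_marks \<omega>' X'"
proof -
  have disj': "Y \<inter> X = {}" "Y' \<inter> X' = {}" using disj by auto
  have comm: "split_marks \<omega> a X a Y = split_marks \<omega> a Y a X"
    "split_marks \<omega>' a X' a Y' = split_marks \<omega>' a Y' a X'"
    by (auto simp: split_marks_commute[of _ _ X] split_marks_commute[of _ _ X'] fun_eq_iff)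
  \<comment> \<open>A largest of the four leaf sets is at least as large as both leaf sets of the
    other 2-star; the four cases differ only by symmetry.\<close>
  consider "card X' \<le> card X" "card Y' \<le> card X" | "card X' \<le> card Y" "card Y' \<le> card Y"
    | "card X \<le> card X'" "card Y \<le> card X'" | "card X \<le> card Y'" "card Y \<le> card Y'"
    by linarith
  then show ?thesis
  proof cases
    case 1
    then show ?thesis
      using split_marks_equal_centers_larger[OF fin disj ne(1) 1 leaves eq] by blast
  next
    case 2
    then show ?thesis
      using split_marks_equal_centers_larger[OF fin(2,1,3,4) disj'(1) disj(2) ne(2) 2
          leaves[unfolded Un_commute[of X]] eq[unfolded Un_commute[of X] comm(1)]] by blast
  next
    case 3
    show ?thesis
      using split_marks_equal_centers_larger[OF fin(3,4,1,2) disj(2,1) ne(3) 3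
          leaves[symmetric] eq[symmetric]] by metis
  next
    case 4
    show ?thesis
      using split_marks_equal_centers_larger[OF fin(4,3,1,2) disj'(2) disj(1) ne(4) 4
          leaves[symmetric, unfolded Un_commute[of X']]
          eq[symmetric, unfolded Un_commute[of X'] comm(2)]] by metis
  qed
qed

section \<open>Isomorphisms from equal weights\<close>

text \<open>Taking images under an injective map is injective on \<open>Pow V\<close>, so a pair
  that is not an edge cannot be sent onto an edge.\<close>

lemma weight_isomorphicI:
  assumes "bij_betw f V V'" "E \<subseteq> Pow V" "(`) f ` E = E'" "\<And>v. v \<in> V \<Longrightarrow> \<omega>' (f v) = \<omega> v"
  shows "weight_isomorphic V E \<omega> V' E' \<omega>'"
proof -
  have inj: "inj_on ((`) f) (Pow V)"
    using assms(1) by (intro inj_on_image_Pow) (simp add: bij_betw_def)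
  have "{u, v} \<in> E \<longleftrightarrow> {f u, f v} \<in> E'" if "u \<in> V" "v \<in> V" for u v
    using inj_on_image_mem_iff[OF inj _ assms(2), of "{u, v}"] that unfolding assms(3) by simp
  then show ?thesis
    unfolding weight_isomorphic_def using assms by blast
qed

lemma double_star_edges_subset: "double_star V E c X d Y \<Longrightarrow> E \<subseteq> Pow V"
  unfolding double_star_def by (auto split: if_splits)

lemma double_star_isomorphic:
  assumes ds: "double_star V E c X d Y" "double_star V' E' c' X' d' Y'"
    and w: "\<omega> c = \<omega>' c'" "\<omega> d = \<omega>' d'"
    and X: "unit_marks \<omega> X = unit_marks \<omega>' X'" and Y: "unit_marks \<omega> Y = unit_marks \<omega>' Y'"
  shows "weight_isomorphic V E \<omega> V' E' \<omega>'"
proof -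
  have fin: "finite X" "finite Y" "finite X'" "finite Y'"
    and sep: "c \<noteq> d" "c \<notin> X" "c \<notin> Y" "d \<notin> X" "d \<notin> Y" "X \<inter> Y = {}" "V = {c} \<union> ({d} \<union> (X \<union> Y))"
    and sep': "c' \<noteq> d'" "c' \<notin> X'" "c' \<notin> Y'" "d' \<notin> X'" "d' \<notin> Y'" "X' \<inter> Y' = {}"
      "V' = {c'} \<union> ({d'} \<union> (X' \<union> Y'))"
    using ds unfolding double_star_def by auto
  have E: "E = insert {c, d} ((\<lambda>x. {if x \<in> X then c else d, x}) ` (X \<union> Y))"
    and E': "E' = insert {c', d'} ((\<lambda>x. {if x \<in> X' then c' else d', x}) ` (X' \<union> Y'))"
    using ds unfolding double_star_def by auto
  obtain g where g: "bij_betw g X X'" "\<And>x. x \<in> X \<Longrightarrow> \<omega>' (g x) = \<omega> x"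
    using unit_marks_eq_imp_bij[OF fin(1,3) X] by blast
  obtain h where h: "bij_betw h Y Y'" "\<And>x. x \<in> Y \<Longrightarrow> \<omega>' (h x) = \<omega> x"
    using unit_marks_eq_imp_bij[OF fin(2,4) Y] by blast
  \<comment> \<open>Centers go to centers, and the leaves of each center are matched by weight with
    those of its image, so edges go to edges.\<close>
  define f where "f v = (if v = c then c' else if v = d then d' else if v \<in> X then g v else h v)" for v
  have fc: "f c = c'" "f d = d'" using sep by (simp_all add: f_def)
  have fX: "f x = g x" if "x \<in> X" for x using that sep by (auto simp: f_def)
  have fY: "f x = h x" if "x \<in> Y" for x using that sep by (auto simp: f_def)
  have "bij_betw f X X'" "bij_betw f Y Y'"
    using g(1) h(1) bij_betw_cong[of X f g] bij_betw_cong[of Y f h] fX fY by auto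
  then have bXY: "bij_betw f (X \<union> Y) (X' \<union> Y')"
    using sep' by (intro bij_betw_combine)
  have "bij_betw f {c} {c'}" "bij_betw f {d} {d'}" using fc by simp_all
  then have bij: "bij_betw f V V'"
    unfolding sep(7) sep'(7) by (intro bij_betw_combine[OF _ bij_betw_combine[OF _ bXY]]) (use sep' in auto)
  have "f ` {if x \<in> X then c else d, x} = {if f x \<in> X' then c' else d', f x}" if "x \<in> X \<union> Y" for x
  proof (cases "x \<in> X")
    case True
    then have "f x \<in> X'" using fX g(1) by (auto simp: bij_betw_def)
    then show ?thesis using True fc by simp
  next
    case False
    then have "f x \<in> Y'" using that fY h(1) by (auto simp: bij_betw_def)
    then have "f x \<notin> X'" using sep' by auto
    then show ?thesis using False fc by simp
  qed
  then have "(`) f ` (\<lambda>x. {if x \<in> X then c else d, x}) ` (X \<union> Y) =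
      (\<lambda>x. {if f x \<in> X' then c' else d', f x}) ` (X \<union> Y)"
    unfolding image_image by (rule image_cong[OF refl])
  also have "\<dots> = (\<lambda>x. {if x \<in> X' then c' else d', x}) ` f ` (X \<union> Y)"
    unfolding image_image ..
  also have "f ` (X \<union> Y) = X' \<union> Y'" using bXY by (simp add: bij_betw_def)
  finally have "(`) f ` E = E'"
    unfolding E E' image_insert by (simp add: fc)
  moreover have "\<omega>' (f v) = \<omega> v" if "v \<in> V" for v
    using that w fc fX fY g(2) h(2) unfolding sep(7) by auto
  ultimately show ?thesis
    using bij double_star_edges_subset[OF ds(1)] by (intro weight_isomorphicI)
qed

text \<open>Here \<open>d\<close> is just one more leaf of \<open>c\<close>. The leaves including
  \<open>d\<close> are matched as a whole, and \<open>d\<close> may be sent to any leaf of its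
  weight.\<close>

lemma star_isomorphic:
  assumes ds: "double_star V E c X d {}" "double_star V' E' c' X' d' {}"
    and w: "\<omega> c = \<omega>' c'"
    and X: "unit_marks \<omega> (insert d X) = unit_marks \<omega>' (insert d' X')"
  shows "weight_isomorphic V E \<omega> V' E' \<omega>'"
proof -
  have fin: "finite (insert d X)" "finite (insert d' X')"
    and sep: "c \<notin> insert d X" "V = {c} \<union> insert d X"
    and sep': "c' \<notin> insert d' X'" "V' = {c'} \<union> insert d' X'"
    using ds unfolding double_star_def by auto
  have E: "E = (\<lambda>x. {c, x}) ` insert d X" and E': "E' = (\<lambda>x. {c', x}) ` insert d' X'"
    using ds unfolding double_star_def by auto
  obtain g where g: "bij_betw g (insert d X) (insert d' X')"
      "\<And>x. x \<in> insert d X \<Longrightarrow> \<omega>' (g x) = \<omega> x"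
    using unit_marks_eq_imp_bij[OF fin X] by blast
  define f where "f = g(c := c')"
  have fg: "f x = g x" if "x \<in> insert d X" for x using that sep by (auto simp: f_def)
  have fc: "f c = c'" by (simp add: f_def)
  have b: "bij_betw f (insert d X) (insert d' X')"
    using g(1) bij_betw_cong[of "insert d X" f g] fg by blast
  have "bij_betw f {c} {c'}" using fc by simp
  then have bij: "bij_betw f V V'"
    unfolding sep(2) sep'(2) using b by (rule bij_betw_combine) (use sep' in auto)
  have "(`) f ` E = (\<lambda>x. {c', x}) ` f ` insert d X"
    unfolding E image_image by (simp add: fc)
  also have "f ` insert d X = insert d' X'" using b by (simp add: bij_betw_def)
  finally have "(`) f ` E = E'" unfolding E' .
  moreover have "\<omega>' (f v) = \<omega> v" if "v \<in> V" for v
    using that w fc fg g(2) unfolding sep(2) by auto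
  ultimately show ?thesis
    using bij double_star_edges_subset[OF ds(1)] by (intro weight_isomorphicI)
qed

section \<open>Reconstruction of stars and of proper 2-stars\<close>

lemma M_poly_eq_imp_double_star_marks_eq:
  assumes ds: "double_star V E c X d Y" "double_star V' E' c' X' d' Y'"
    and M: "M_poly V E (marked_version \<omega>) = M_poly V' E' (marked_version \<omega>')"
  shows "double_star_marks \<omega> (\<omega> c) X (\<omega> d) Y = double_star_marks \<omega>' (\<omega>' c') X' (\<omega>' d') Y'"
proof -
  have fin: "finite V" "finite E" "finite V'" "finite E'"
    using ds unfolding double_star_def by auto
  show ?thesis
    using M_poly_eq_imp_component_marks_eq[OF fin M]
    by (simp add: component_marks_double_star[OF ds(1)] component_marks_double_star[OF ds(2)])
qed

text \<open>The size exceeds the number of leaves by the number of centers without leaves, so it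
  distinguishes stars from proper 2-stars.\<close>

lemma leaf_marks_proper:
  assumes "finite X" "finite Y" "X \<inter> Y = {}"
  shows "size (leaf_marks (double_star_marks \<omega> a X b Y)) = card (X \<union> Y) \<longleftrightarrow> X \<noteq> {} \<and> Y \<noteq> {}"
  using assms by (auto simp: leaf_marks_double_star)

lemma star_reconstruction:
  assumes ds: "double_star V E c X d {}" "double_star V' E' c' X' d' {}"
    and M: "M_poly V E (marked_version \<omega>) = M_poly V' E' (marked_version \<omega>')"
  shows "weight_isomorphic V E \<omega> V' E' \<omega>'"
proof -
  have fin: "finite X" "finite X'" "d \<notin> X" "d' \<notin> X'" using ds unfolding double_star_def by auto
  note marks = M_poly_eq_imp_double_star_marks_eq[OF ds M]
  have W: "unit_marks \<omega> X + {#(\<omega> c, 0), (\<omega> d, 0)#} = unit_marks \<omega>' X' + {#(\<omega>' c', 0), (\<omega>' d', 0)#}"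
    using double_star_marks_eq_imp_weights_eq[OF _ _ _ _ marks] fin by simp
  have card: "card X = card X'" using arg_cong[OF W, of size] fin by simp
  show ?thesis
  \<comment> \<open>A single edge is special: both ends are leaves, and only the unordered pair of
    weights is available, so the ends may have to be exchanged.\<close>
  proof (cases "X = {}")
    case True
    then have "X' = {}" using card fin by simp
    with True W consider "\<omega> c = \<omega>' c'" "\<omega> d = \<omega>' d'" | "\<omega> c = \<omega>' d'" "\<omega> d = \<omega>' c'"
      by (auto simp: unit_marks_def add_eq_conv_ex)
    then show ?thesis
    proof cases
      case 1
      then show ?thesis using True \<open>X' = {}\<close> double_star_isomorphic[OF ds] by (simp add: unit_marks_def)
    next
      case 2
      then show ?thesis using True \<open>X' = {}\<close> double_star_isomorphic[OF ds(1) double_star_commute[OF ds(2)]]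
        by (simp add: unit_marks_def)
    qed
  next
    case False
    \<comment> \<open>The center \<open>c\<close> now has dots when the central edge is deleted, so
      \<open>leaf_marks\<close> consists of the weights of \<open>X\<close> and of \<open>d\<close>.
      What remains of all weights is that of \<open>c\<close>.\<close>
    then have "card X \<noteq> 0" "card X' \<noteq> 0" using card fin by auto
    then have "unit_marks \<omega> (insert d X) = unit_marks \<omega>' (insert d' X')"
      using arg_cong[OF marks, of leaf_marks] fin
      by (simp add: leaf_marks_double_star) (simp add: unit_marks_def)
    moreover from this have "\<omega> c = \<omega>' c'"
      using W fin by (simp add: unit_marks_def)
    ultimately show ?thesis using star_isomorphic[OF ds] by blast
  qed
qed

lemma proper_reconstruction:
  assumes ds: "double_star V E c X d Y" "double_star V' E' c' X' d' Y'"
    and ne: "X \<noteq> {}" "Y \<noteq> {}" "X' \<noteq> {}" "Y' \<noteq> {}"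
    and M: "M_poly V E (marked_version \<omega>) = M_poly V' E' (marked_version \<omega>')"
  shows "weight_isomorphic V E \<omega> V' E' \<omega>'"
proof -
  \<comment> \<open>The center weights will be known only as an unordered pair. The primed data are
    therefore kept arbitrary, so that the description with exchanged centers can be inserted
    too.\<close>
  have main: ?thesis
    if ds': "double_star V' E' c' X' d' Y'" and ne': "X' \<noteq> {}" "Y' \<noteq> {}"
      and a: "\<omega> c = \<omega>' c'" and b: "\<omega> d = \<omega>' d'"
      and L: "unit_marks \<omega> (X \<union> Y) = unit_marks \<omega>' (X' \<union> Y')" for c' X' d' Y'
  proof -
    have fin: "finite X" "finite Y" "finite X'" "finite Y'"
      and disj: "X \<inter> Y = {}" "X' \<inter> Y' = {}"
      using ds(1) ds' unfolding double_star_def by auto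
    have fused: "image_mset (fused_marks \<omega> (\<omega> c + \<omega> d) (X \<union> Y)) (mset_set (Pow (X \<union> Y))) =
      image_mset (fused_marks \<omega>' (\<omega> c + \<omega> d) (X' \<union> Y')) (mset_set (Pow (X' \<union> Y')))"
      using fin L by (intro fused_marks_cong) auto
    \<comment> \<open>The contribution of the sets with the central edge agrees on both sides and is
      cancelled.\<close>
    have split: "image_mset (split_marks \<omega> (\<omega> c) X (\<omega> d) Y) (mset_set (Pow (X \<union> Y))) =
      image_mset (split_marks \<omega>' (\<omega> c) X' (\<omega> d) Y') (mset_set (Pow (X' \<union> Y')))"
      using M_poly_eq_imp_double_star_marks_eq[OF ds(1) ds' M] fused
      unfolding double_star_marks_def a[symmetric] b[symmetric] by simp
    show ?thesis
    proof (cases "\<omega> c = \<omega> d")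
      case True
      have "unit_marks \<omega> X = unit_marks \<omega>' X' \<and> unit_marks \<omega> Y = unit_marks \<omega>' Y' \<or>
        unit_marks \<omega> X = unit_marks \<omega>' Y' \<and> unit_marks \<omega> Y = unit_marks \<omega>' X'"
        using split_marks_equal_centers[OF fin disj ne(1,2) ne' L] split True by simp
      then show ?thesis
      proof (elim disjE conjE)
        assume "unit_marks \<omega> X = unit_marks \<omega>' X'" "unit_marks \<omega> Y = unit_marks \<omega>' Y'"
        then show ?thesis using double_star_isomorphic[OF ds(1) ds' a b] by blast
      next
        assume "unit_marks \<omega> X = unit_marks \<omega>' Y'" "unit_marks \<omega> Y = unit_marks \<omega>' X'"
        \<comment> \<open>All centers have the same weight in this case, so exchanging the primed
          centers still preserves weights.\<close>
        then show ?thesis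
          using double_star_isomorphic[OF ds(1) double_star_commute[OF ds'], where \<omega> = \<omega> and \<omega>' = \<omega>'] a b True by simp
      qed
    next
      case False
      have "unit_marks \<omega> X + unit_marks \<omega> Y = unit_marks \<omega>' X' + unit_marks \<omega>' Y'"
        using L by (simp add: unit_marks_Un fin disj)
      moreover have "image_mset (\<lambda>p. {#(\<omega> c, 0), p#}) (unit_marks \<omega> X) +
          image_mset (\<lambda>p. {#(\<omega> d, 0), p#}) (unit_marks \<omega> Y) =
        image_mset (\<lambda>p. {#(\<omega> c, 0), p#}) (unit_marks \<omega>' X') +
          image_mset (\<lambda>p. {#(\<omega> d, 0), p#}) (unit_marks \<omega>' Y')"
        using edge_marks_split[OF fin(1,2) disj(1), of \<omega> "\<omega> c" "\<omega> d"]
          edge_marks_split[OF fin(3,4) disj(2), of \<omega>' "\<omega> c" "\<omega> d"]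
        unfolding L split by simp
      ultimately have "unit_marks \<omega> X = unit_marks \<omega>' X' \<and> unit_marks \<omega> Y = unit_marks \<omega>' Y'"
        using False by (intro edge_marks_determine[of "(\<omega> c, 0)" "(\<omega> d, 0)"]) auto
      then show ?thesis using double_star_isomorphic[OF ds(1) ds' a b] by blast
    qed
  qed
  have fin: "finite X" "finite Y" "finite X'" "finite Y'"
    and disj: "X \<inter> Y = {}" "X' \<inter> Y' = {}"
    using ds unfolding double_star_def by auto
  note marks = M_poly_eq_imp_double_star_marks_eq[OF ds M]
  have L: "unit_marks \<omega> (X \<union> Y) = unit_marks \<omega>' (X' \<union> Y')"
    using arg_cong[OF marks, of leaf_marks] ne by (simp add: leaf_marks_double_star fin disj)
  \<comment> \<open>Removing the leaf weights from all weights leaves the two center weights,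
    without their order.\<close>
  then have "{#(\<omega> c, 0), (\<omega> d, 0)#} = {#(\<omega>' c', 0), (\<omega>' d', 0 :: nat)#}"
    using double_star_marks_eq_imp_weights_eq[OF fin marks] by (metis add_left_imp_eq)
  then consider "\<omega> c = \<omega>' c'" "\<omega> d = \<omega>' d'" | "\<omega> c = \<omega>' d'" "\<omega> d = \<omega>' c'"
    by (auto simp: add_eq_conv_ex)
  then show ?thesis
  proof cases
    case 1
    then show ?thesis using main[OF ds(2) ne(3,4)] L by blast
  next
    case 2
    then show ?thesis
      using main[OF double_star_commute[OF ds(2)] ne(4,3)] L by (simp add: Un_commute)
  qed
qed

theorem theorem7p8:
  fixes V :: "'a set" and E :: "'a set set" and \<omega> :: "'a \<Rightarrow> nat"
    and V' :: "'b set" and E' :: "'b set set" and \<omega>' :: "'b \<Rightarrow> nat"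
  assumes "weighted_two_star V E \<omega>"
    and "weighted_two_star V' E' \<omega>'"
    and "M_poly V E (marked_version \<omega>) = M_poly V' E' (marked_version \<omega>')"
  shows "weight_isomorphic V E \<omega> V' E' \<omega>'"
proof -
  obtain c X d Y where ds: "double_star V E c X d Y"
    using assms(1) two_star_imp_double_star unfolding weighted_two_star_def by blast
  obtain c' X' d' Y' where ds': "double_star V' E' c' X' d' Y'"
    using assms(2) two_star_imp_double_star unfolding weighted_two_star_def by blast
  have fin: "finite X" "finite Y" "finite X'" "finite Y'"
    and disj: "X \<inter> Y = {}" "X' \<inter> Y' = {}"
    using ds ds' unfolding double_star_def by auto
  note marks = M_poly_eq_imp_double_star_marks_eq[OF ds ds' assms(3)]
  \<comment> \<open>The number of vertices, hence of leaves, is needed to compare the sizes of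
    \<open>leaf_marks\<close> with the same number on both sides.\<close>
  have "card (X \<union> Y) = card (X' \<union> Y')"
    using arg_cong[OF double_star_marks_eq_imp_weights_eq[OF fin marks], of size] fin by simp
  then have "X \<noteq> {} \<and> Y \<noteq> {} \<longleftrightarrow> X' \<noteq> {} \<and> Y' \<noteq> {}"
    using leaf_marks_proper[OF fin(1,2) disj(1)] leaf_marks_proper[OF fin(3,4) disj(2)] marks
    by metis
  then consider "X \<noteq> {}" "Y \<noteq> {}" "X' \<noteq> {}" "Y' \<noteq> {}" | "X = {} \<or> Y = {}" "X' = {} \<or> Y' = {}"
    by blast
  then show ?thesis
  proof cases
    case 1
    then show ?thesis using proper_reconstruction[OF ds ds'] assms(3) by blast
  next
    case 2
    \<comment> \<open>In each of the two trees the roles of the centers are chosen so that the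
      center without leaves comes second.\<close>
    obtain p P q where "double_star V E p P q {}"
      using 2(1) ds double_star_commute[OF ds] by blast
    moreover obtain p' P' q' where "double_star V' E' p' P' q' {}"
      using 2(2) ds' double_star_commute[OF ds'] by blast
    ultimately show ?thesis by (rule star_reconstruction[OF _ _ assms(3)])
  qed
qed

end
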